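(* Let $\alpha,\beta>-1$ with $\alpha-\beta>-1$, and let $P^{(\alpha,\beta)}_{n,k}(x,y)$, $0\le k\le n$, be the Laguerre-Laguerre Koornwinder polynomials. For $k\geq 0$ and $n\geq k+1$, $$\frac{\partial}{\partial \alpha} P^{(\alpha,\beta)}_{n,k}(x,y)=\sum_{s=0}^{n-k-1}\frac{1}{n-k-s}P^{(\alpha,\beta)}_{k+s,k}(x,y),$$ and $\frac{\partial}{\partial \alpha} P^{(\alpha,\beta)}_{n,n}(x,y)=0$ for $n=k\geq 0$. Moreover, for $n\geq k\geq 1$, $$\frac{\partial}{\partial \beta}P^{(\alpha,\beta)}_{n,k}(x,y)=\sum_{s=0}^{k-1}\frac{1}{s+1}\, x^{s+1}P^{(\alpha+2s+2,\beta)}_{n-s-1,k-s-1}(x,y),$$ and $\frac{\partial}{\partial \beta}P^{(\alpha,\beta)}_{n,0}(x,y)=0$ for $n\geq 0$, $k=0$.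
   Context: The generalized Laguerre polynomials are $L_{n}^{(a)}(x)=\frac{x^{-a}e^{x}}{n!}\frac{d^{n}}{dx^{n}}\{e^{-x}x^{n+a}\}$. For $\alpha,\beta>-1$ with $\alpha-\beta>-1$ and integers $0\le k\le n$, the Laguerre-Laguerre Koornwinder polynomials are $$P^{(\alpha,\beta)}_{n,k}(x,y)=L^{(\alpha+2k+1)}_{n-k}(x)\,x^{k}\,L^{(\beta)}_{k}\!\left(\frac{y}{x}\right),$$ understood as polynomials in $x,y$. Each partial derivative with respect to one parameter is taken with the other parameter and $x,y$ fixed. *)

theory Defs
  imports "HOL-Analysis.Analysis" "HOL-Computational_Algebra.Polynomial"
begin

text \<open>
  Rodrigues' formula makes literal sense for \<open>x > 0\<close> only; the generalized Laguerre polynomial is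
  the polynomial that agrees with it there. Existence, uniqueness and the bound on the degree are
  shown in \<open>laguerre_Rodrigues\<close>, \<open>laguerre_unique\<close> and \<open>degree_laguerre_le\<close> below.
\<close>

definition rodrigues :: "nat \<Rightarrow> real \<Rightarrow> real \<Rightarrow> real" where
  "rodrigues n a x =
     x powr (- a) * exp x / fact n * (deriv ^^ n) (\<lambda>t. exp (- t) * t powr (real n + a)) x"

definition laguerre :: "nat \<Rightarrow> real \<Rightarrow> real poly" where
  "laguerre n a = (THE p. \<forall>x>0. poly p x = rodrigues n a x)"

lemma rodrigues_aux:
  "\<exists>p. degree p \<le> m \<and>
     (\<forall>x>0. (deriv ^^ m) (\<lambda>t. exp (- t) * t powr b) x = exp (- x) * x powr (b - real m) * poly p x)"
proof (induction m)
  case 0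
  show ?case by (rule exI[of _ 1]) simp
next
  case (Suc m)
  let ?f = "\<lambda>t::real. exp (- t) * t powr b"
  from Suc obtain p where deg: "degree p \<le> m"
    and p: "\<And>x. x > 0 \<Longrightarrow> (deriv ^^ m) ?f x = exp (- x) * x powr (b - real m) * poly p x"
    by blast
  define q where "q = [:b - real m, -1:] * p + [:0, 1:] * pderiv p"
  have "degree ([:b - real m, -1:] * p) \<le> Suc m"
    by (rule order.trans[OF degree_mult_le]) (use deg in simp)
  moreover have "degree ([:0, 1:] * pderiv p) \<le> Suc m"
    by (rule order.trans[OF degree_mult_le]) (use deg in \<open>simp add: degree_pderiv\<close>)
  ultimately have "degree q \<le> Suc m"
    unfolding q_def by (rule degree_add_le)
  moreover have "(deriv ^^ Suc m) ?f x = exp (- x) * x powr (b - real (Suc m)) * poly q x"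
    if x: "x > 0" for x
  proof -
    have "((\<lambda>x. exp (- x) * x powr (b - real m) * poly p x) has_real_derivative
        (exp (- x) * x powr (b - real (Suc m)) * poly q x)) (at x)"
    proof -
      have pw: "x powr (b - real m) = x * x powr (b - real (Suc m))"
        using x powr_add[of x 1 "b - real (Suc m)"] by (simp add: algebra_simps)
      have "((\<lambda>x. x powr (b - real m)) has_real_derivative
          (b - real m) * x powr (b - real (Suc m))) (at x)"
        using has_real_derivative_powr[OF x, of "b - real m"] by (simp add: algebra_simps)
      then have "((\<lambda>x. exp (- x) * x powr (b - real m) * poly p x) has_real_derivative
          ((exp (- x) * (-1)) * x powr (b - real m) +
            ((b - real m) * x powr (b - real (Suc m))) * exp (- x)) * poly p x +
          poly (pderiv p) x * (exp (- x) * x powr (b - real m))) (at x)"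
        by (intro DERIV_mult poly_DERIV) (auto intro!: derivative_eq_intros)
      then show ?thesis
        by (rule DERIV_cong) (simp only: pw, simp add: q_def algebra_simps)
    qed
    then have "((deriv ^^ m) ?f has_real_derivative
        (exp (- x) * x powr (b - real (Suc m)) * poly q x)) (at x)"
      by (rule has_field_derivative_transform_within_open[of _ _ _ "{0<..}"]) (use x p in auto)
    then show ?thesis by (simp add: DERIV_imp_deriv)
  qed
  ultimately show ?case by blast
qed

lemma rodrigues_poly: "\<exists>p. degree p \<le> n \<and> (\<forall>x>0. poly p x = rodrigues n a x)"
proof -
  obtain p where deg: "degree p \<le> n" and p: "\<And>x. x > 0 \<Longrightarrow>
      (deriv ^^ n) (\<lambda>t. exp (- t) * t powr (real n + a)) x = exp (- x) * x powr a * poly p x"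
    using rodrigues_aux[of n "real n + a"] by auto
  have "poly (smult (1 / fact n) p) x = rodrigues n a x" if "x > 0" for x
    using that by (simp only: rodrigues_def p) (simp add: powr_minus exp_minus field_simps)
  moreover have "degree (smult (1 / fact n) p) \<le> n"
    using deg by simp
  ultimately show ?thesis by blast
qed

lemma poly_eq_of_pos:
  assumes "\<And>x::real. x > 0 \<Longrightarrow> poly p x = poly q x"
  shows "p = q"
proof (rule ccontr)
  assume "p \<noteq> q"
  then have "finite {x. poly (p - q) x = 0}" by (intro poly_roots_finite) simp
  moreover have "{0<..} \<subseteq> {x. poly (p - q) x = 0}" using assms by auto
  ultimately show False using infinite_Ioi finite_subset by blast
qed

lemma laguerre_unique:
  assumes "\<And>x. x > 0 \<Longrightarrow> poly p x = rodrigues n a x"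
  shows "laguerre n a = p"
  unfolding laguerre_def by (rule the_equality) (use assms in \<open>auto intro: poly_eq_of_pos\<close>)

lemma laguerre_Rodrigues: "x > 0 \<Longrightarrow> poly (laguerre n a) x = rodrigues n a x"
  using rodrigues_poly[of n a] laguerre_unique by blast

lemma degree_laguerre_le: "degree (laguerre n a) \<le> n"
  using rodrigues_poly[of n a] laguerre_unique by blast

text \<open>
  The factor \<open>x\<^sup>k L\<^sub>k(y/x)\<close> is entered as the polynomial in \<open>x\<close> and \<open>y\<close> that it denotes, so that
  \<open>x = 0\<close> is covered; \<open>koornwinder_eq\<close> gives the quotient form for \<open>x \<noteq> 0\<close>.
  The indices are meant to satisfy \<open>k \<le> n\<close>.
\<close>

definition koornwinder :: "real \<Rightarrow> real \<Rightarrow> nat \<Rightarrow> nat \<Rightarrow> real \<Rightarrow> real \<Rightarrow> real" where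
  "koornwinder \<alpha> \<beta> n k x y =
     poly (laguerre (n - k) (\<alpha> + 2 * real k + 1)) x *
     (\<Sum>i\<le>k. coeff (laguerre k \<beta>) i * x ^ (k - i) * y ^ i)"

lemma koornwinder_eq:
  assumes "x \<noteq> 0"
  shows "koornwinder \<alpha> \<beta> n k x y =
     poly (laguerre (n - k) (\<alpha> + 2 * real k + 1)) x * x ^ k * poly (laguerre k \<beta>) (y / x)"
proof -
  have "poly (laguerre k \<beta>) (y / x) = (\<Sum>i\<le>k. coeff (laguerre k \<beta>) i * (y / x) ^ i)"
    unfolding poly_altdef
    by (rule sum.mono_neutral_left) (auto simp: degree_laguerre_le coeff_eq_0 not_le)
  then have "x ^ k * poly (laguerre k \<beta>) (y / x) =
      (\<Sum>i\<le>k. x ^ k * (coeff (laguerre k \<beta>) i * (y / x) ^ i))"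
    by (simp add: sum_distrib_left)
  also have "\<dots> = (\<Sum>i\<le>k. coeff (laguerre k \<beta>) i * x ^ (k - i) * y ^ i)"
    by (rule sum.cong) (use assms in \<open>auto simp: power_diff power_divide field_simps\<close>)
  finally show ?thesis by (simp add: koornwinder_def mult.assoc)
qed

end

theory Submission
  imports Defs
begin

text \<open>
  Both derivatives come from one addition formula for Laguerre polynomials,
  \<open>L\<^sub>n\<^sup>(\<^sup>a\<^sup>+\<^sup>h\<^sup>) = \<Sum>\<^sub>s\<^sub>\<le>\<^sub>n (h)\<^sub>n\<^sub>-\<^sub>s / (n - s)! \<cdot> L\<^sub>s\<^sup>(\<^sup>a\<^sup>)\<close>,
  where \<open>(h)\<^sub>j\<close> is the rising factorial (\<open>laguerre_add\<close>). In terms of generating functions it says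
  that raising the parameter by \<open>h\<close> multiplies \<open>\<Sum>\<^sub>n L\<^sub>n t\<^sup>n\<close> by \<open>(1 - t)\<close> to the power \<open>-h\<close>; on the
  level of coefficients, which Rodrigues' formula gives as
  \<open>(-1)\<^sup>i / i! \<cdot> (a + i + 1)\<^sub>n\<^sub>-\<^sub>i / (n - i)!\<close> (\<open>coeff_laguerre\<close>), it is the Vandermonde convolution of
  rising factorials.

  The right-hand side depends on \<open>h\<close> only through \<open>(h)\<^sub>j / j!\<close> with \<open>j = n - s\<close>, whose derivative at
  \<open>h = 0\<close> is \<open>1 / j\<close> for \<open>j > 0\<close> and \<open>0\<close> for \<open>j = 0\<close>. Hence
  \<open>\<partial>L\<^sub>n/\<partial>a = \<Sum>\<^sub>s\<^sub><\<^sub>n L\<^sub>s / (n - s)\<close>, both for values and for single coefficients. A Koornwinder polynomial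
  has \<open>\<alpha>\<close> only in its first factor, where this is applied to values. It has \<open>\<beta>\<close> only in its second
  factor, the homogenization \<open>x\<^sup>k L\<^sub>k(y/x)\<close>, where it is applied to coefficients; each drop of the
  degree from \<open>k\<close> to \<open>k - s - 1\<close> leaves a factor \<open>x\<^sup>s\<^sup>+\<^sup>1\<close>, and the shift of \<open>\<alpha>\<close> by \<open>2s + 2\<close> keeps the
  parameter \<open>\<alpha> + 2k + 1\<close> of the first factor unchanged.
\<close>

section \<open>Coefficients of the Laguerre polynomials\<close>

text \<open>
  Leibniz' rule for the product of \<open>e\<^sup>-\<^sup>t\<close> and \<open>t\<^sup>b\<close>, with the common factor \<open>e\<^sup>-\<^sup>x x\<^sup>b\<^sup>-\<^sup>m\<close> taken out: the
  \<open>i\<close>-th coefficient collects the terms in which \<open>i\<close> of the \<open>m\<close> derivatives fall on the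
  exponential. The induction step is Pascal's rule.
\<close>

lemma higher_deriv_exp_powr:
  "\<exists>p. (\<forall>i. coeff p i = (-1) ^ i * real (m choose i) * pochhammer (b - real m + real i + 1) (m - i)) \<and>
     (\<forall>x>0. (deriv ^^ m) (\<lambda>t. exp (- t) * t powr b) x = exp (- x) * x powr (b - real m) * poly p x)"
proof (induction m)
  case 0
  have "coeff 1 i = (-1) ^ i * real (0 choose i) * pochhammer (b - real 0 + real i + 1) (0 - i)" for i
    by (cases i) auto
  then show ?case by (intro exI[of _ 1]) simp
next
  case (Suc m)
  let ?f = "\<lambda>t::real. exp (- t) * t powr b"
  from Suc obtain p where
    c: "\<And>i. coeff p i = (-1) ^ i * real (m choose i) * pochhammer (b - real m + real i + 1) (m - i)"
    and p: "\<And>x. x > 0 \<Longrightarrow> (deriv ^^ m) ?f x = exp (- x) * x powr (b - real m) * poly p x"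
    by blast
  (* The derivative of e^-x x^(b-m) p(x) is e^-x x^(b-m-1) times this polynomial. *)
  define q where "q = [:b - real m, -1:] * p + [:0, 1:] * pderiv p"
  have q_coeff: "coeff q i = (b - real m + real i) * coeff p i - (if i = 0 then 0 else coeff p (i - 1))" for i
    by (cases i) (auto simp: q_def coeff_pCons coeff_pderiv algebra_simps)
  have "coeff q i = (-1) ^ i * real (Suc m choose i) *
      pochhammer (b - real (Suc m) + real i + 1) (Suc m - i)" for i
  proof -
    have poch: "(b - real m + real i) * pochhammer (b - real m + real i + 1) (m - i) =
        pochhammer (b - real m + real i) (Suc m - i)" if "i \<le> m"
      using that by (simp add: Suc_diff_le pochhammer_rec)
    show ?thesis
    proof (cases i)
      case 0
      then show ?thesis using poch by (simp add: q_coeff c)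
    next
      case (Suc j)
      show ?thesis
      proof (cases "i \<le> m")
        case True
        have "coeff q i = (-1) ^ i * real (m choose i) *
            ((b - real m + real i) * pochhammer (b - real m + real i + 1) (m - i)) +
            (-1) ^ i * real (m choose j) * pochhammer (b - real m + real i) (Suc m - i)"
          unfolding q_coeff c using Suc by (simp add: algebra_simps)
        then show ?thesis unfolding poch[OF True] using Suc by (simp add: algebra_simps)
      next
        case False
        then show ?thesis using Suc by (auto simp: q_coeff c algebra_simps binomial_eq_0)
      qed
    qed
  qed
  moreover have "(deriv ^^ Suc m) ?f x = exp (- x) * x powr (b - real (Suc m)) * poly q x"
    if x: "x > 0" for x
  proof -
    have pw: "x powr (b - real m) = x * x powr (b - real (Suc m))"
      using x powr_add[of x 1 "b - real (Suc m)"] by (simp add: algebra_simps)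
    have "((\<lambda>x. x powr (b - real m)) has_real_derivative
        (b - real m) * x powr (b - real (Suc m))) (at x)"
      using has_real_derivative_powr[OF x, of "b - real m"] by (simp add: algebra_simps)
    then have "((\<lambda>x. exp (- x) * x powr (b - real m) * poly p x) has_real_derivative
        ((exp (- x) * (-1)) * x powr (b - real m) +
          ((b - real m) * x powr (b - real (Suc m))) * exp (- x)) * poly p x +
        poly (pderiv p) x * (exp (- x) * x powr (b - real m))) (at x)"
      by (intro DERIV_mult poly_DERIV) (auto intro!: derivative_eq_intros)
    then have "((\<lambda>x. exp (- x) * x powr (b - real m) * poly p x) has_real_derivative
        (exp (- x) * x powr (b - real (Suc m)) * poly q x)) (at x)"
      by (rule DERIV_cong) (simp only: pw, simp add: q_def algebra_simps)
    then have "((deriv ^^ m) ?f has_real_derivative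
        (exp (- x) * x powr (b - real (Suc m)) * poly q x)) (at x)"
      by (rule has_field_derivative_transform_within_open[of _ _ _ "{0<..}"]) (use x p in auto)
    then show ?thesis by (simp add: DERIV_imp_deriv)
  qed
  ultimately show ?case by blast
qed

lemma coeff_laguerre:
  assumes "i \<le> n"
  shows "coeff (laguerre n a) i =
    (-1) ^ i / fact i * (pochhammer (a + real i + 1) (n - i) / fact (n - i))"
proof -
  obtain p where
    c: "\<And>i. coeff p i = (-1) ^ i * real (n choose i) * pochhammer (a + real i + 1) (n - i)"
    and p: "\<And>x. x > 0 \<Longrightarrow> (deriv ^^ n) (\<lambda>t. exp (- t) * t powr (real n + a)) x =
      exp (- x) * x powr a * poly p x"
    using higher_deriv_exp_powr[of n "real n + a"] by auto
  have "laguerre n a = smult (1 / fact n) p"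
  proof (rule laguerre_unique)
    fix x :: real assume "x > 0"
    then show "poly (smult (1 / fact n) p) x = rodrigues n a x"
      by (simp only: rodrigues_def p) (simp add: powr_minus exp_minus field_simps)
  qed
  then show ?thesis using assms by (simp add: c binomial_fact)
qed

lemma coeff_laguerre_eq_0: "n < i \<Longrightarrow> coeff (laguerre n a) i = 0"
  using degree_laguerre_le[of n a] by (intro coeff_eq_0) simp

section \<open>Addition formula and parameter derivative\<close>

text \<open>
  For a fixed power \<open>i\<close> the coefficients form, up to the sign and \<open>i!\<close>, the sequence \<open>(a + i + 1)\<^sub>l / l!\<close>
  starting at \<open>n = i\<close>; convolving it with \<open>(h)\<^sub>l / l!\<close> shifts \<open>a\<close> by \<open>h\<close>.
\<close>

lemma laguerre_add:
  "laguerre n (a + h) = (\<Sum>s\<le>n. smult (pochhammer h (n - s) / fact (n - s)) (laguerre s a))"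
proof (rule poly_eqI)
  fix i
  show "coeff (laguerre n (a + h)) i =
    coeff (\<Sum>s\<le>n. smult (pochhammer h (n - s) / fact (n - s)) (laguerre s a)) i"
  proof (cases "i \<le> n")
    case True
    define m where "m = n - i"
    have n: "n = i + m" using True by (simp add: m_def)
    let ?g = "\<lambda>s. pochhammer h (n - s) / fact (n - s) * coeff (laguerre s a) i"
    have "(\<Sum>s\<le>n. ?g s) = (\<Sum>s\<in>{i..i + m}. ?g s)"
      by (rule sum.mono_neutral_right) (auto simp: n coeff_laguerre_eq_0)
    also have "\<dots> = (\<Sum>l\<le>m. ?g (i + l))"
      by (rule sum.reindex_bij_witness[of _ "\<lambda>l. i + l" "\<lambda>s. s - i"]) auto
    also have "\<dots> = (\<Sum>l\<le>m. (-1) ^ i / fact i * (real (m choose l) *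
        pochhammer (a + real i + 1) l * pochhammer h (m - l) / fact m))"
      by (rule sum.cong) (auto simp: n coeff_laguerre binomial_fact mult_ac)
    also have "\<dots> = (-1) ^ i / fact i * (pochhammer (a + real i + 1 + h) m / fact m)"
      by (simp add: pochhammer_binomial_sum sum_distrib_left sum_divide_distrib)
    also have "\<dots> = coeff (laguerre n (a + h)) i"
      by (simp add: n coeff_laguerre algebra_simps)
    finally show ?thesis by (simp add: coeff_sum)
  qed (auto simp: coeff_sum coeff_laguerre_eq_0)
qed

lemma has_real_derivative_pochhammer_0:
  "((\<lambda>h. pochhammer h (Suc m)) has_real_derivative fact m) (at 0)"
proof (induction m)
  case 0
  then show ?case by simp
next
  case (Suc m)
  have "((\<lambda>h. pochhammer h (Suc m) * (h + real (Suc m))) has_real_derivative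
      fact m * (0 + real (Suc m)) + 1 * pochhammer 0 (Suc m)) (at 0)"
    by (rule DERIV_mult[OF Suc]) (auto intro!: derivative_eq_intros)
  then show ?case by (simp add: pochhammer_Suc[of _ "Suc m"] pochhammer_0_left mult.commute)
qed

text \<open>
  The addition formula differentiated term by term. The coefficients \<open>c s\<close> stand for the values or the
  single coefficients of the \<open>L\<^sub>s\<close>; the term \<open>s = n\<close> is constant in \<open>b\<close>.
\<close>

lemma has_real_derivative_pochhammer_sum:
  "((\<lambda>b. \<Sum>s\<le>n. pochhammer (b - a) (n - s) / fact (n - s) * c s) has_real_derivative
     (\<Sum>s<n. c s / real (n - s))) (at a)"
proof -
  have *: "((\<lambda>b. pochhammer (b - a) (n - s) / fact (n - s) * c s) has_real_derivative
      (if s < n then c s / real (n - s) else 0)) (at a)" for s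
  proof (cases "s < n")
    case True
    then obtain m where m: "n - s = Suc m" using zero_less_diff gr0_implies_Suc by blast
    have "((\<lambda>b. pochhammer (b - a) (Suc m)) has_real_derivative fact m) (at a)"
      using has_real_derivative_pochhammer_0[of m]
        DERIV_shift[of "\<lambda>b. pochhammer (b - a) (Suc m)" "fact m" 0 a] by simp
    then have "((\<lambda>b. pochhammer (b - a) (Suc m) / fact (Suc m) * c s) has_real_derivative
        fact m / fact (Suc m) * c s) (at a)"
      by (intro DERIV_cmult_right DERIV_cdivide)
    moreover have "fact m / fact (Suc m) * c s = c s / real (Suc m)"
      by simp
    ultimately show ?thesis using True by (simp only: m if_True)
  qed simp
  have "(\<Sum>s<n. c s / real (n - s)) = (\<Sum>s\<le>n. if s < n then c s / real (n - s) else 0)"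
    by (rule sum.mono_neutral_cong_left) auto
  then show ?thesis by (simp only: DERIV_sum[OF *])
qed

lemma has_real_derivative_poly_laguerre:
  "((\<lambda>b. poly (laguerre n b) x) has_real_derivative
     (\<Sum>s<n. poly (laguerre s a) x / real (n - s))) (at a)"
proof -
  have "poly (laguerre n b) x =
      (\<Sum>s\<le>n. pochhammer (b - a) (n - s) / fact (n - s) * poly (laguerre s a) x)" for b
    using laguerre_add[of n a "b - a"] by (simp add: poly_sum)
  then show ?thesis by (simp only: has_real_derivative_pochhammer_sum)
qed

lemma has_real_derivative_coeff_laguerre:
  "((\<lambda>b. coeff (laguerre n b) i) has_real_derivative
     (\<Sum>s<n. coeff (laguerre s a) i / real (n - s))) (at a)"
proof -
  have "coeff (laguerre n b) i =
      (\<Sum>s\<le>n. pochhammer (b - a) (n - s) / fact (n - s) * coeff (laguerre s a) i)" for b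
    using laguerre_add[of n a "b - a"] by (simp add: coeff_sum)
  then show ?thesis by (simp only: has_real_derivative_pochhammer_sum)
qed

section \<open>Koornwinder polynomials\<close>

lemma has_real_derivative_koornwinder_alpha:
  "((\<lambda>a. koornwinder a \<beta> n k x y) has_real_derivative
     (\<Sum>s<n - k. koornwinder \<alpha> \<beta> (k + s) k x y / real (n - k - s))) (at \<alpha>)"
proof -
  let ?Q = "\<Sum>i\<le>k. coeff (laguerre k \<beta>) i * x ^ (k - i) * y ^ i"
  let ?c = "2 * real k + 1"
  have "((\<lambda>a. poly (laguerre (n - k) (a + ?c)) x) has_real_derivative
      (\<Sum>s<n - k. poly (laguerre s (\<alpha> + ?c)) x / real (n - k - s))) (at \<alpha>)"
    using has_real_derivative_poly_laguerre[of "n - k" x "\<alpha> + ?c"] by (simp only: DERIV_shift)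
  from DERIV_cmult_right[OF this, of ?Q] show ?thesis
    unfolding koornwinder_def by (simp add: sum_distrib_right add.assoc)
qed

lemma has_real_derivative_koornwinder_beta:
  "((\<lambda>b. koornwinder \<alpha> b n k x y) has_real_derivative
     (\<Sum>s<k. x ^ (s + 1) / real (s + 1) *
        koornwinder (\<alpha> + 2 * real s + 2) \<beta> (n - s - 1) (k - s - 1) x y)) (at \<beta>)"
proof -
  let ?L = "poly (laguerre (n - k) (\<alpha> + 2 * real k + 1)) x"
  let ?H = "\<lambda>k. \<Sum>i\<le>k. coeff (laguerre k \<beta>) i * x ^ (k - i) * y ^ i"
  have "((\<lambda>b. ?L * (\<Sum>i\<le>k. coeff (laguerre k b) i * x ^ (k - i) * y ^ i)) has_real_derivative
      ?L * (\<Sum>i\<le>k. (\<Sum>j<k. coeff (laguerre j \<beta>) i / real (k - j)) * x ^ (k - i) * y ^ i)) (at \<beta>)"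
    by (intro DERIV_cmult DERIV_sum DERIV_cmult_right has_real_derivative_coeff_laguerre)
  also have "(\<Sum>i\<le>k. (\<Sum>j<k. coeff (laguerre j \<beta>) i / real (k - j)) * x ^ (k - i) * y ^ i) =
      (\<Sum>j<k. \<Sum>i\<le>k. coeff (laguerre j \<beta>) i / real (k - j) * x ^ (k - i) * y ^ i)"
    by (subst sum.swap) (simp add: sum_distrib_right)
  also have "\<dots> = (\<Sum>j<k. x ^ (k - j) / real (k - j) * ?H j)"
  proof (rule sum.cong[OF refl])
    fix j assume "j \<in> {..<k}"
    then have j: "j < k" by simp
    (* Homogenizing a polynomial of degree at most j to degree k instead of j costs x^(k-j). *)
    have "(\<Sum>i\<le>k. coeff (laguerre j \<beta>) i / real (k - j) * x ^ (k - i) * y ^ i) =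
        (\<Sum>i\<le>j. coeff (laguerre j \<beta>) i / real (k - j) * x ^ (k - i) * y ^ i)"
      by (rule sum.mono_neutral_right) (use j in \<open>auto simp: coeff_laguerre_eq_0\<close>)
    also have "\<dots> = (\<Sum>i\<le>j. x ^ (k - j) / real (k - j) *
        (coeff (laguerre j \<beta>) i * x ^ (j - i) * y ^ i))"
    proof (rule sum.cong[OF refl])
      fix i assume "i \<in> {..j}"
      then have "x ^ (k - i) = x ^ (k - j) * x ^ (j - i)"
        using j by (simp flip: power_add)
      then show "coeff (laguerre j \<beta>) i / real (k - j) * x ^ (k - i) * y ^ i =
          x ^ (k - j) / real (k - j) * (coeff (laguerre j \<beta>) i * x ^ (j - i) * y ^ i)"
        by simp
    qed
    finally show "(\<Sum>i\<le>k. coeff (laguerre j \<beta>) i / real (k - j) * x ^ (k - i) * y ^ i) =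
        x ^ (k - j) / real (k - j) * ?H j"
      by (simp add: sum_distrib_left)
  qed
  also have "\<dots> = (\<Sum>s<k. x ^ (s + 1) / real (s + 1) * ?H (k - s - 1))"
    by (rule sum.reindex_bij_witness[of _ "\<lambda>s. k - s - 1" "\<lambda>j. k - j - 1"])
      (auto simp: Suc_diff_Suc simp del: power_Suc)
  also have "?L * \<dots> = (\<Sum>s<k. x ^ (s + 1) / real (s + 1) *
      koornwinder (\<alpha> + 2 * real s + 2) \<beta> (n - s - 1) (k - s - 1) x y)"
  proof -
    have "koornwinder (\<alpha> + 2 * real s + 2) \<beta> (n - s - 1) (k - s - 1) x y = ?L * ?H (k - s - 1)"
      if "s < k" for s
    proof -
      have "n - s - 1 - (k - s - 1) = n - k" using that by simp
      moreover have "\<alpha> + 2 * real s + 2 + 2 * real (k - s - 1) + 1 = \<alpha> + 2 * real k + 1"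
        using that by (simp add: of_nat_diff)
      ultimately show ?thesis unfolding koornwinder_def by (simp only:)
    qed
    then show ?thesis by (simp add: sum_distrib_left mult.left_commute)
  qed
  finally show ?thesis by (simp only: koornwinder_def)
qed

theorem theorem4:
  fixes \<alpha> \<beta> :: real
  assumes "\<alpha> > -1" and "\<beta> > -1" and "\<alpha> - \<beta> > -1"
  shows
    "(\<forall>(n::nat) (k::nat) (x::real) (y::real). k + 1 \<le> n \<longrightarrow>
        ((\<lambda>a. koornwinder a \<beta> n k x y) has_real_derivative
          (\<Sum>s = 0..n - k - 1. 1 / real (n - k - s) * koornwinder \<alpha> \<beta> (k + s) k x y)) (at \<alpha>)) \<and>
     (\<forall>(n::nat) (x::real) (y::real).
        ((\<lambda>a. koornwinder a \<beta> n n x y) has_real_derivative 0) (at \<alpha>)) \<and>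
     (\<forall>(n::nat) (k::nat) (x::real) (y::real). 1 \<le> k \<and> k \<le> n \<longrightarrow>
        ((\<lambda>b. koornwinder \<alpha> b n k x y) has_real_derivative
          (\<Sum>s = 0..k - 1. 1 / real (s + 1) * x ^ (s + 1) *
             koornwinder (\<alpha> + 2 * real s + 2) \<beta> (n - s - 1) (k - s - 1) x y)) (at \<beta>)) \<and>
     (\<forall>(n::nat) (x::real) (y::real).
        ((\<lambda>b. koornwinder \<alpha> b n 0 x y) has_real_derivative 0) (at \<beta>))"
proof (intro conjI allI impI)
  fix n k :: nat and x y :: real
  assume "k + 1 \<le> n"
  then have "{0..n - k - 1} = {..<n - k}" by auto
  then show "((\<lambda>a. koornwinder a \<beta> n k x y) has_real_derivative
      (\<Sum>s = 0..n - k - 1. 1 / real (n - k - s) * koornwinder \<alpha> \<beta> (k + s) k x y)) (at \<alpha>)"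
    using has_real_derivative_koornwinder_alpha[of \<beta> n k x y \<alpha>] by simp
next
  fix n :: nat and x y :: real
  show "((\<lambda>a. koornwinder a \<beta> n n x y) has_real_derivative 0) (at \<alpha>)"
    using has_real_derivative_koornwinder_alpha[of \<beta> n n x y \<alpha>] by simp
next
  fix n k :: nat and x y :: real
  assume "1 \<le> k \<and> k \<le> n"
  then have "{0..k - 1} = {..<k}" by auto
  then show "((\<lambda>b. koornwinder \<alpha> b n k x y) has_real_derivative
      (\<Sum>s = 0..k - 1. 1 / real (s + 1) * x ^ (s + 1) *
         koornwinder (\<alpha> + 2 * real s + 2) \<beta> (n - s - 1) (k - s - 1) x y)) (at \<beta>)"
    using has_real_derivative_koornwinder_beta[of \<alpha> n k x y \<beta>] by simp
next
  fix n :: nat and x y :: real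
  show "((\<lambda>b. koornwinder \<alpha> b n 0 x y) has_real_derivative 0) (at \<beta>)"
    using has_real_derivative_koornwinder_beta[of \<alpha> n 0 x y \<beta>] by simp
qed

end
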